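(* Let $G$ be a graph. All roots of the acyclic polynomial $A(G,x)$ are real if and only if $G$ is a forest.
   Context: Graphs are finite, undirected and simple. The acyclic polynomial of a graph $G$ is $A(G,x)=\sum_{i\ge 0} a_i x^i$, where $a_i=|\{S\subseteq V(G): |S|=i \text{ and } G[S] \text{ is acyclic}\}|$ and $G[S]$ is the subgraph of $G$ induced by $S$ (acyclic means containing no cycle; the empty set is acyclic). A forest is an acyclic graph. *)

theory Defs
  imports Complex_Main "HOL-Computational_Algebra.Polynomial" "Graph_Theory.Graph_Theory"
begin

text \<open>
  Finite simple undirected graphs are the symmetric digraphs of locale \<^locale>\<open>graph\<close>:
  an undirected edge is a pair of opposite arcs.  Each edge therefore yields a closed
  directed walk of length two, which satisfies \<^const>\<open>pre_digraph.cycle\<close> but is not a cycle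
  of the undirected graph.  Closed walks without repeated vertices and of length at least
  three are exactly the (oriented, rooted) cycles of the undirected graph.  For the same
  reason the library's \<^const>\<open>forest\<close> is not the undirected notion.
\<close>

definition undirected_cycle :: "('a, 'b) pre_digraph \<Rightarrow> 'b list \<Rightarrow> bool" where
  "undirected_cycle G p \<longleftrightarrow> pre_digraph.cycle G p \<and> 3 \<le> length p"

definition acyclic_graph :: "('a, 'b) pre_digraph \<Rightarrow> bool" where
  "acyclic_graph G \<longleftrightarrow> (\<nexists>p. undirected_cycle G p)"

definition acyclic_count :: "('a, 'b) pre_digraph \<Rightarrow> nat \<Rightarrow> nat" where
  "acyclic_count G i = card {S. S \<subseteq> verts G \<and> card S = i \<and> acyclic_graph (G \<restriction> S)}"

text \<open>The sum may stop at the order of the graph: all later coefficients vanish.\<close>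

definition acyclic_poly :: "('a, 'b) pre_digraph \<Rightarrow> int poly" where
  "acyclic_poly G = (\<Sum>i\<le>card (verts G). monom (int (acyclic_count G i)) i)"

end

theory Submission
  imports Defs "HOL-Computational_Algebra.Fundamental_Theorem_Algebra"
    "HOL-Analysis.Convex"
begin

text \<open>
  Let \<open>G\<close> have \<open>n\<close> vertices. If \<open>G\<close> is a forest, then every vertex set induces an acyclic
  graph, so \<open>A(G,x) = (1 + x)\<^sup>n\<close>, whose only possible root is \<open>-1\<close>.

  Conversely, a cycle has at least three vertices, so the constant, linear and quadratic
  coefficients of \<open>A(G,x)\<close> always agree with those of \<open>(1 + x)\<^sup>n\<close>. Suppose that all roots
  are real and write \<open>A(G,x) = (1 - s\<^sub>1 x) \<dots> (1 - s\<^sub>d x)\<close>, where the \<open>s\<^sub>i\<close> are the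
  reciprocals of the roots and \<open>d\<close> is the degree. The low coefficients determine the power
  sums: \<open>\<Sum>s\<^sub>i = -n\<close> and \<open>\<Sum>s\<^sub>i\<^sup>2 = n\<^sup>2 - n(n - 1) = n\<close>. As the \<open>s\<^sub>i\<close> are real, the
  Cauchy-Schwarz inequality gives \<open>n\<^sup>2 \<le> d n\<close>, whence \<open>d \<ge> n\<close>. Then the coefficient of
  \<open>x\<^sup>n\<close> does not vanish, so the whole vertex set induces an acyclic graph, namely \<open>G\<close>.

  The inequality for real-rooted polynomials is \<open>real_rooted_coeff_ineq\<close>; the low
  coefficients come from \<open>acyclic_count_eq_choose\<close>.
\<close>

lemma low_coeffs_prod_linear:
  fixes s :: "nat \<Rightarrow> 'a :: comm_ring_1"
  shows "coeff (\<Prod>i<d. [:1, - s i:]) 0 = 1"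
    and "coeff (\<Prod>i<d. [:1, - s i:]) 1 = - (\<Sum>i<d. s i)"
    and "(\<Sum>i<d. s i)\<^sup>2 = (\<Sum>i<d. (s i)\<^sup>2) + 2 * coeff (\<Prod>i<d. [:1, - s i:]) 2"
proof (induction d)
  case (Suc d)
  let ?P = "\<Prod>i<d. [:1, - s i:]"
  have P: "(\<Prod>i<Suc d. [:1, - s i:]) = ?P + pCons 0 (smult (- s d) ?P)"
    by (simp add: mult.commute)
  show "coeff (\<Prod>i<Suc d. [:1, - s i:]) 0 = 1"
    unfolding P using Suc.IH by simp
  show "coeff (\<Prod>i<Suc d. [:1, - s i:]) 1 = - (\<Sum>i<Suc d. s i)"
    unfolding P using Suc.IH by simp
  have "coeff (\<Prod>i<Suc d. [:1, - s i:]) 2 = coeff ?P 2 + s d * (\<Sum>i<d. s i)"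
    unfolding P using Suc.IH by (simp add: numeral_2_eq_2)
  then show "(\<Sum>i<Suc d. s i)\<^sup>2 =
      (\<Sum>i<Suc d. (s i)\<^sup>2) + 2 * coeff (\<Prod>i<Suc d. [:1, - s i:]) 2"
    using Suc.IH(3) by (simp add: power2_eq_square algebra_simps)
qed auto

text \<open>
  Factoring the reflected polynomial instead of the polynomial itself gives the reciprocals
  of the roots directly. The left-hand side of the inequality below is the square of their
  sum, and the factor in parentheses is the sum of their squares.
\<close>

lemma real_rooted_coeff_ineq:
  fixes p :: "real poly"
  assumes c0: "coeff p 0 = 1"
    and real: "\<And>z::complex. poly (map_poly of_real p) z = 0 \<Longrightarrow> z \<in> \<real>"
  shows "(coeff p 1)\<^sup>2 \<le> real (degree p) * ((coeff p 1)\<^sup>2 - 2 * coeff p 2)"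
proof -
  define P :: "complex poly" where "P = map_poly of_real p"
  have coeff_P: "coeff P k = of_real (coeff p k)" for k
    by (simp add: P_def coeff_map_poly)
  have P0: "coeff P 0 = 1" and deg_P: "degree P = degree p"
    by (simp_all add: coeff_P c0, simp add: P_def degree_map_poly)
  obtain s where "smult (lead_coeff (reflect_poly P))
      (\<Prod>i<degree (reflect_poly P). [:- s i, 1:]) = reflect_poly P"
    by (rule complex_poly_decompose')
  then have refl: "reflect_poly P = (\<Prod>i<degree p. [:- s i, 1:])"
    using P0 deg_P by (simp add: coeff_reflect_poly)
  have s_real: "s i \<in> \<real>" if "i < degree p" for i
  proof (cases "s i = 0")
    case False
    have "poly (reflect_poly P) (s i) = 0"
      unfolding refl poly_prod using that by (intro prod_zero) auto
    then have "poly P (inverse (s i)) = 0"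
      using False by (simp add: poly_reflect_poly_nz)
    then have "inverse (s i) \<in> \<real>"
      using real unfolding P_def by blast
    then show ?thesis
      by (metis Reals_inverse inverse_inverse_eq)
  qed simp
  have "reflect_poly [:- s i, 1:] = [:1, - s i:]" for i
    by (cases "s i = 0") (simp_all add: reflect_poly_pCons reflect_poly_pCons')
  then have P_prod: "P = (\<Prod>i<degree p. [:1, - s i:])"
    using reflect_poly_reflect_poly[of P] P0 by (simp add: refl reflect_poly_prod)
  define r where "r i = Re (s i)" for i
  have s_r: "s i = of_real (r i)" if "i < degree p" for i
    using s_real[OF that] by (simp add: r_def)
  have "complex_of_real (coeff p 1) = of_real (- (\<Sum>i<degree p. r i))"
    using low_coeffs_prod_linear(2)[of s "degree p", folded P_prod] by (simp add: coeff_P s_r)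
  then have sum1: "(\<Sum>i<degree p. r i) = - coeff p 1"
    by (simp only: of_real_eq_iff)
  have "complex_of_real ((\<Sum>i<degree p. r i)\<^sup>2) =
      of_real ((\<Sum>i<degree p. (r i)\<^sup>2) + 2 * coeff p 2)"
    using low_coeffs_prod_linear(3)[of s "degree p", folded P_prod] by (simp add: coeff_P s_r)
  then have "(\<Sum>i<degree p. r i)\<^sup>2 = (\<Sum>i<degree p. (r i)\<^sup>2) + 2 * coeff p 2"
    by (simp only: of_real_eq_iff)
  then have sum2: "(\<Sum>i<degree p. (r i)\<^sup>2) = (coeff p 1)\<^sup>2 - 2 * coeff p 2"
    by (simp add: sum1)
  have "(\<Sum>i<degree p. r i)\<^sup>2 \<le> (\<Sum>i<degree p. (r i)\<^sup>2) * real (degree p)"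
    using sum_squared_le_sum_of_squares[of r "{..<degree p}"] by simp
  then show ?thesis
    by (simp add: sum1 sum2 mult.commute)
qed

lemma (in wf_digraph) induce_subgraph_verts_self: "G \<restriction> verts G = G"
  by (intro pre_digraph.equality) (auto simp: induce_subgraph_def)

lemma (in wf_digraph) acyclic_graph_induce_subgraph:
  assumes "acyclic_graph G" and "S \<subseteq> verts G"
  shows "acyclic_graph (G \<restriction> S)"
  using assms subgraph_cycle[OF subgraph_induce_subgraphI]
  by (auto simp: acyclic_graph_def undirected_cycle_def)

lemma (in wf_digraph) undirected_cycle_card_verts:
  assumes "undirected_cycle G p" and "finite (verts G)"
  shows "3 \<le> card (verts G)"
proof -
  obtain u where u: "awalk u p u" "distinct (tl (awalk_verts u p))" and p: "3 \<le> length p"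
    using assms(1) by (auto simp: undirected_cycle_def cycle_def)
  \<comment> \<open>The base point is both the first and the last vertex of the closed walk; without its
      first entry, the walk visits as many distinct vertices as it has arcs.\<close>
  have "set (tl (awalk_verts u p)) \<subseteq> verts G"
    using u(1) by (meson awalkE' list.set_sel(2) awalk_verts_non_Nil subset_iff)
  then have "card (set (tl (awalk_verts u p))) \<le> card (verts G)"
    by (intro card_mono assms(2))
  then show ?thesis
    using distinct_card[OF u(2)] p by (simp add: length_awalk_verts)
qed

lemma (in fin_digraph) acyclic_count_eq_choose:
  assumes "acyclic_graph G \<or> i < 3"
  shows "acyclic_count G i = card (verts G) choose i"
proof -
  have "acyclic_graph (G \<restriction> S)" if S: "S \<subseteq> verts G" "card S = i" for S
  proof (cases "acyclic_graph G")
    case True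
    then show ?thesis
      using S by (rule_tac acyclic_graph_induce_subgraph)
  next
    case False
    interpret H: wf_digraph "G \<restriction> S"
      by (rule wellformed_induce_subgraph)
    have "finite S"
      using S(1) finite_verts finite_subset by blast
    then show ?thesis
      using False assms S H.undirected_cycle_card_verts
      by (fastforce simp: acyclic_graph_def)
  qed
  then have "{S. S \<subseteq> verts G \<and> card S = i \<and> acyclic_graph (G \<restriction> S)} =
      {S. S \<subseteq> verts G \<and> card S = i}"
    by auto
  then show ?thesis
    by (simp add: acyclic_count_def n_subsets)
qed

lemma coeff_acyclic_poly:
  assumes "finite (verts G)"
  shows "coeff (acyclic_poly G) i = int (acyclic_count G i)"
proof (cases "i \<le> card (verts G)")
  case True
  then show ?thesis
    by (simp add: acyclic_poly_def coeff_sum)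
next
  case False
  then have no_sets: "{S. S \<subseteq> verts G \<and> card S = i \<and> acyclic_graph (G \<restriction> S)} = {}"
    using card_mono[OF assms] by auto
  show ?thesis
    unfolding acyclic_count_def no_sets using False by (simp add: acyclic_poly_def coeff_sum)
qed

lemma (in fin_digraph) acyclic_poly_forest:
  assumes "acyclic_graph G"
  shows "map_poly of_int (acyclic_poly G) = ([:1, 1:] :: complex poly) ^ card (verts G)"
proof (rule poly_eqI)
  fix i
  show "coeff (map_poly of_int (acyclic_poly G)) i =
      coeff (([:1, 1:] :: complex poly) ^ card (verts G)) i"
    using assms
    by (cases "i \<le> card (verts G)")
       (simp_all add: coeff_map_poly coeff_acyclic_poly acyclic_count_eq_choose
         coeff_linear_poly_power coeff_eq_0 degree_power_eq)
qed

lemma (in fin_digraph) acyclic_graph_if_real_rooted: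
  assumes "\<And>z::complex. poly (map_poly of_int (acyclic_poly G)) z = 0 \<Longrightarrow> z \<in> \<real>"
  shows "acyclic_graph G"
proof -
  define n where "n = card (verts G)"
  define p :: "real poly" where "p = map_poly of_int (acyclic_poly G)"
  have coeff_p: "coeff p i = real (acyclic_count G i)" for i
    by (simp add: p_def coeff_map_poly coeff_acyclic_poly)
  have c: "coeff p i = real (n choose i)" if "i < 3" for i
    using that by (simp add: coeff_p acyclic_count_eq_choose n_def)
  have "map_poly complex_of_real p = map_poly of_int (acyclic_poly G)"
    by (rule poly_eqI) (simp add: p_def coeff_map_poly)
  then have "(coeff p 1)\<^sup>2 \<le> real (degree p) * ((coeff p 1)\<^sup>2 - 2 * coeff p 2)"
    using assms by (intro real_rooted_coeff_ineq) (simp_all add: c)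
  moreover have "2 * real (n choose 2) = real n * (real n - 1)"
    by (cases n)
       (simp_all add: choose_two field_char_0_class.of_nat_div mod_eq_0_iff_dvd algebra_simps)
  ultimately have "real n * real n \<le> real n * real (degree p)"
    by (simp add: c power2_eq_square algebra_simps)
  then have "n \<le> degree p"
    by (cases "n = 0") auto
  moreover have "degree p \<le> n"
    by (rule degree_le)
      (auto simp: coeff_p acyclic_count_def n_def dest: card_mono[OF finite_verts])
  ultimately have "coeff p n \<noteq> 0"
    using c[of 0] by (metis leading_coeff_0_iff le_antisym coeff_0 binomial_n_0
      of_nat_1 zero_less_numeral zero_neq_one)
  then obtain S where S: "S \<subseteq> verts G" "card S = n" "acyclic_graph (G \<restriction> S)"
    unfolding coeff_p acyclic_count_def by (metis (mono_tags, lifting) card.empty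
      empty_Collect_eq of_nat_0)
  then have "S = verts G"
    by (simp add: card_subset_eq n_def)
  then show ?thesis
    using S(3) by (simp add: induce_subgraph_verts_self)
qed

theorem theorem2p16:
  fixes G :: "('a, 'b) pre_digraph"
  assumes "graph G"
  shows "(\<forall>z::complex. poly (map_poly of_int (acyclic_poly G)) z = 0 \<longrightarrow> z \<in> \<real>) \<longleftrightarrow> acyclic_graph G"
proof -
  interpret graph G
    by (rule assms)
  have "z \<in> \<real>"
    if "acyclic_graph G" and z: "poly (map_poly of_int (acyclic_poly G)) z = 0"
    for z :: complex
  proof -
    have "(1 + z) ^ card (verts G) = 0"
      using z by (simp add: acyclic_poly_forest[OF that(1)])
    then have "z = - 1"
      by (simp add: add_eq_0_iff)
    then show ?thesis
      by simp
  qed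
  then show ?thesis
    using acyclic_graph_if_real_rooted by blast
qed

end
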